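(* Let $a<b$, let $c\neq 0$ be a constant, and let $u(x,t)$ be the exact solution of $u_t+cu_x=0$ on $[a,b]$ with non-negative initial datum and with periodic, Dirichlet or Neumann boundary condition (Dirichlet/Neumann data being prescribed at the inflow end: $x=a$ if $c>0$, $x=b$ if $c<0$); the exact solution satisfies $u(x,t)\ge 0$. Consider a family of uniform discretizations $x_i=a+i\Delta x$, $i=0,\dots,M$, $\Delta x=(b-a)/M$, with time step $\Delta t>0$ satisfying $\Delta t=\mathcal{O}(\Delta x)$. Let $u^n_i\ge 0$ ($0\le i\le M$) be the numerical solution at time level $t^n$, let $u^{n+1}_i$ be the values computed from it by one step of the WENO MOL$^T$ scheme (defined in the context), and let $u^{new}_i$ be the values obtained from $(u^n_i)$ and $(u^{n+1}_i)$ by the positivity-preserving limiter (defined in the context). Assume that $u^{n+1}_i$ is $p$-th order accurate in space and $q$-th order accurate in time, i.e. there is a constant $C$, independent of $\Delta x$ and $\Delta t$, with $$e^{n+1}_i=|u^{n+1}_i-u(x_i,t^{n+1})|\le C(\Delta x^p+\Delta t^q)\qquad\text{for all } i .$$ Then, in the worst case, the limited solution satisfies $$\tilde e^{\,n+1}_i=|u^{new}_i-u(x_i,t^{n+1})|=\mathcal{O}(\Delta x^{p-1}+\Delta x^{-1}\Delta t^q)\qquad\text{for all } i ,$$ that is, there is a constant $C'$, independent of $\Delta x$ and $\Delta t$, such that one always has $\tilde e^{\,n+1}_i\le C'(\Delta x^{p-1}+\Delta x^{-1}\Delta t^q)$ for all $i$.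
   Context: **WENO MOL$^T$ scheme.** Fix an $s$-stage diagonally implicit Runge--Kutta method with lower triangular matrix $\mathbf A=(a_{ij})$ with nonzero diagonal, weights $\mathbf b$, and $\Lambda=\mathrm{diag}(a_{11},\dots,a_{ss})$; fix also an integer $k\ge 2$. Given grid values $u^n$, the stages $u^{(1)},\dots,u^{(s)}$ are computed successively. Let $\mathbf 1=(1,\dots,1)^T$, $\mathbf U=(u^{(1)},\dots,u^{(s)})^T$, and let $w^{(m)}$ be the $m$-th component of $u^n\Lambda\mathbf A^{-1}\mathbf 1+(\mathbf A-\Lambda)\mathbf A^{-1}\mathbf U$ (it involves only $u^n,u^{(1)},\dots,u^{(m-1)}$). Put $\alpha_m=1/|c\,a_{mm}\Delta t|$. If $c\,a_{mm}>0$, $$u^{(m)}_i=I^L_i+A^{(m)}e^{-\alpha_m(x_i-a)},\qquad I^L_0=0,\quad I^L_i=I^L_{i-1}e^{-\alpha_m\Delta x}+J^L_i ,$$ where $J^L_i$ approximates $\alpha_m\int_{x_{i-1}}^{x_i}e^{-\alpha_m(x_i-y)}v(y)\,dy$ with $v=w^{(m)}$. If $c\,a_{mm}<0$, the mirror image is used: $u^{(m)}_i=I^R_i+B^{(m)}e^{-\alpha_m(b-x_i)}$, $I^R_M=0$, $I^R_i=I^R_{i+1}e^{-\alpha_m\Delta x}+J^R_i$. Finally $u^{n+1}=u^n+\mathbf b^T\mathbf A^{-1}(\mathbf U-u^n\mathbf 1)$. *WENO integration.* For $r=0,\dots,k-1$ let $p_r$ be the polynomial of degree at most $k$ interpolating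 $v$ at $x_{i-r-1},\dots,x_{i-r-1+k}$, and let $p$ be the polynomial of degree at most $2k-1$ interpolating $v$ at $x_{i-k},\dots,x_{i+k-1}$. Set $J^L_{i,r}=\alpha_m\int_{x_{i-1}}^{x_i}e^{-\alpha_m(x_i-y)}p_r(y)\,dy$; let $d_r$ be the linear weights, with $\sum_r d_r=1$, such that $\alpha_m\int_{x_{i-1}}^{x_i}e^{-\alpha_m(x_i-y)}p(y)\,dy=\sum_r d_rJ^L_{i,r}$ for all $v$. Then $J^L_i=\sum_r\omega_rJ^L_{i,r}$ with $\omega_r=\tilde\omega_r/\sum_s\tilde\omega_s$, $\tilde\omega_r=d_r/(\epsilon+\beta_r)^2$, $\epsilon=10^{-6}$, $\beta_r=\sum_{l=1}^k\int_{x_{i-1}}^{x_i}\Delta x^{2l-1}(p_r^{(l)}(x))^2dx$. $J^R_i$ is mirror-symmetric. *Ghost values* of $v$ at $x_{-i}=x_0-i\Delta x$ and $x_{M+i}=x_M+i\Delta x$, $1\le i\le k-1$: by periodicity in the periodic case; otherwise, on the left, $v_{-i}=\sum_{r=0}^{2k-2}\omega_rp_r(x_{-i})$, where now $p_r$ interpolates $v$ at $x_0,\dots,x_r$ (degree at most $r$), $d_r=\Delta x^{2k-2-r}$ for $r\le 2k-3$, $d_{2k-2}=1-\sum_{r\le 2k-3}d_r$, $\omega_r$ is formed from $d_r,\beta_r$ as before, $\beta_0=\Delta x^2$ and $\beta_r=\sum_{l=1}^r\int_{x_{-1}}^{x_0}\Delta x^{2l-1}(p_r^{(l)}(x))^2dx$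 for $r\ge1$; symmetrically on the right. *Boundary constants.* Periodic case: $A^{(m)}=\big(\sum_{i=0}^{M-1}u^n_i-\sum_{i=0}^{M-1}I^L_i\big)/\sum_{i=0}^{M-1}e^{-i\alpha_m\Delta x}$ and $u^{(m)}_M=u^{(m)}_0$ for the left-to-right form; $B^{(m)}=\big(\sum_{i=1}^{M}u^n_i-\sum_{i=1}^{M}I^R_i\big)/\sum_{i=1}^{M}e^{-(M-i)\alpha_m\Delta x}$ and $u^{(m)}_0=u^{(m)}_M$ for the right-to-left form. In particular the sum of the grid values over one period is preserved by a step. Dirichlet or Neumann case: $A^{(m)}$, $B^{(m)}$ are real constants prescribed from the boundary data at each stage. **Positivity-preserving limiter, case $c>0$.** Define artificial fluxes by $\hat f_{-1/2}=0$ and $\hat f_{i+1/2}=\hat f_{i-1/2}-\frac{\Delta x}{\Delta t}(u^{n+1}_i-u^n_i)$, $i=0,\dots,M$, so that $u^{n+1}_i=u^n_i-\frac{\Delta t}{\Delta x}(\hat f_{i+1/2}-\hat f_{i-1/2})$. Modified fluxes $\tilde f$ are constructed as below, and $u^{new}_i=u^n_i-\frac{\Delta t}{\Delta x}(\tilde f_{i+1/2}-\tilde f_{i-1/2})$. *Dirichlet or Neumann:* $\tilde f_{-1/2}=\hat f_{-1/2}$, $\tilde f_{1/2}=\hat f_{1/2}$, and successively for $i=1,\dots,M$, with $u^{n+1,1}_i=u^n_i-\frac{\Delta t}{\Delta x}(\hat f_{i+1/2}-\tilde f_{i-1/2})$, $$\tilde f_{i+1/2}=\begin{cases}\tilde f_{i-1/2}+\frac{\Delta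 x}{\Delta t}u^n_i,& u^{n+1,1}_i<0,\\ \hat f_{i+1/2},&\text{otherwise.}\end{cases}$$ *Periodic:* First sweep: $\hat{\hat f}_{-1/2}=\hat f_{-1/2}$ and, for $i=0,\dots,M-1$, with $u^{n+1,1}_i=u^n_i-\frac{\Delta t}{\Delta x}(\hat f_{i+1/2}-\hat{\hat f}_{i-1/2})$, set $\hat{\hat f}_{i+1/2}=\hat{\hat f}_{i-1/2}+\frac{\Delta x}{\Delta t}u^n_i$ if $u^{n+1,1}_i<0$, and $\hat{\hat f}_{i+1/2}=\hat f_{i+1/2}$ otherwise. Second sweep: set $\tilde f_{-1/2}=\hat{\hat f}_{M-1/2}$; starting from $i=0$, compute $u^{n+1,2}_i=u^n_i-\frac{\Delta t}{\Delta x}(\hat{\hat f}_{i+1/2}-\tilde f_{i-1/2})$; if it is negative, set $\tilde f_{i+1/2}=\tilde f_{i-1/2}+\frac{\Delta x}{\Delta t}u^n_i$ and pass to $i+1$; otherwise set $\tilde f_{j+1/2}=\hat{\hat f}_{j+1/2}$ for all $i\le j\le M-1$ and stop. Here $u^{new}_i$ is computed for $0\le i\le M-1$ and $u^{new}_M=u^{new}_0$. **Case $c<0$.** The mirror image: apply the procedure for $c>0$ to the reflected data $(u^n_{M-i})_i$, $(u^{n+1}_{M-i})_i$ and reflect the result back. *)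

theory Defs
  imports "HOL-Analysis.Analysis" "HOL-Computational_Algebra.Polynomial"
begin

text \<open>The function argument is the boundary datum at the inflow end, as a function of time.\<close>

datatype boundary = Periodic | Dirichlet "real \<Rightarrow> real" | Neumann "real \<Rightarrow> real"

definition inflow :: "real \<Rightarrow> real \<Rightarrow> real \<Rightarrow> real" where
  "inflow a b c = (if c > 0 then a else b)"

definition satisfies_boundary ::
    "real \<Rightarrow> real \<Rightarrow> real \<Rightarrow> boundary \<Rightarrow> (real \<Rightarrow> real \<Rightarrow> real) \<Rightarrow> bool" where
  "satisfies_boundary a b c bc u \<longleftrightarrow>
     (case bc of
        Periodic \<Rightarrow> \<forall>t\<ge>0. u a t = u b t
      | Dirichlet g \<Rightarrow> \<forall>t>0. u (inflow a b c) t = g t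
      | Neumann g \<Rightarrow> \<forall>t>0. ((\<lambda>x. u x t) has_real_derivative g t) (at (inflow a b c) within {a..b}))"

text \<open>Classical solutions of \<open>u\<^sub>t + c u\<^sub>x = 0\<close> on \<open>[a,b]\<close> with initial datum \<open>u0\<close>.\<close>

definition advection_solution ::
    "real \<Rightarrow> real \<Rightarrow> real \<Rightarrow> boundary \<Rightarrow> (real \<Rightarrow> real) \<Rightarrow> (real \<Rightarrow> real \<Rightarrow> real) \<Rightarrow> bool" where
  "advection_solution a b c bc u0 u \<longleftrightarrow>
     continuous_on ({a..b} \<times> {0..}) (\<lambda>(x, t). u x t) \<and>
     (\<forall>x\<in>{a<..<b}. \<forall>t>0. \<exists>ut ux.
        ((\<lambda>\<tau>. u x \<tau>) has_real_derivative ut) (at t) \<and>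
        ((\<lambda>y. u y t) has_real_derivative ux) (at x) \<and>
        ut + c * ux = 0) \<and>
     (\<forall>x\<in>{a..b}. u x 0 = u0 x) \<and>
     satisfies_boundary a b c bc u"

text \<open>Grid functions \<open>nat \<Rightarrow> real\<close> matter on \<open>{0..M}\<close> only; grid functions \<open>int \<Rightarrow> real\<close>
  include ghost values. The grid is mapped to itself by \<open>x \<mapsto> a + b - x\<close>, which
  sends \<open>x\<^sub>i\<close> to \<open>x\<^sub>M\<^sub>-\<^sub>i\<close>, so mirror images are formed by reflecting the
  data only.\<close>

definition node :: "real \<Rightarrow> real \<Rightarrow> int \<Rightarrow> real" where
  "node a h i = a + of_int i * h"

definition mirror :: "nat \<Rightarrow> (nat \<Rightarrow> real) \<Rightarrow> nat \<Rightarrow> real" where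
  "mirror M v = (\<lambda>i. v (M - i))"

text \<open>Interpolant of \<open>v\<close> at the \<open>n + 1\<close> nodes \<open>x\<^sub>l, \<dots>, x\<^sub>l\<^sub>+\<^sub>n\<close>.\<close>

definition interp_poly :: "real \<Rightarrow> real \<Rightarrow> (int \<Rightarrow> real) \<Rightarrow> int \<Rightarrow> nat \<Rightarrow> real poly" where
  "interp_poly a h v l n =
     (THE p. degree p \<le> n \<and> (\<forall>j\<in>{l..l + int n}. poly p (node a h j) = v j))"

definition exp_integral :: "real \<Rightarrow> real \<Rightarrow> real \<Rightarrow> int \<Rightarrow> real poly \<Rightarrow> real" where
  "exp_integral a h \<alpha> i p =
     \<alpha> * integral {node a h (i - 1)..node a h i} (\<lambda>y. exp (- \<alpha> * (node a h i - y)) * poly p y)"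

definition smoothness :: "real \<Rightarrow> real \<Rightarrow> nat \<Rightarrow> int \<Rightarrow> real poly \<Rightarrow> real" where
  "smoothness a h n i p =
     (\<Sum>l=1..n. integral {node a h (i - 1)..node a h i}
                  (\<lambda>x. h ^ (2 * l - 1) * (poly ((pderiv ^^ l) p) x)\<^sup>2))"

text \<open>Normalised over the indices \<open>r < n\<close>.\<close>

definition weno_weight :: "nat \<Rightarrow> (nat \<Rightarrow> real) \<Rightarrow> (nat \<Rightarrow> real) \<Rightarrow> nat \<Rightarrow> real" where
  "weno_weight n d \<beta> r =
     (let \<epsilon> = 1 / 10 ^ 6; \<omega>' = (\<lambda>r. d r / (\<epsilon> + \<beta> r)\<^sup>2) in \<omega>' r / (\<Sum>s<n. \<omega>' s))"

definition stencil_poly :: "nat \<Rightarrow> real \<Rightarrow> real \<Rightarrow> (int \<Rightarrow> real) \<Rightarrow> int \<Rightarrow> nat \<Rightarrow> real poly" where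
  "stencil_poly k a h v i r = interp_poly a h v (i - int r - 1) k"

definition linear_weights :: "nat \<Rightarrow> real \<Rightarrow> real \<Rightarrow> real \<Rightarrow> int \<Rightarrow> (nat \<Rightarrow> real) \<Rightarrow> bool" where
  "linear_weights k a h \<alpha> i d \<longleftrightarrow>
     (\<Sum>r<k. d r) = 1 \<and>
     (\<forall>v. exp_integral a h \<alpha> i (interp_poly a h v (i - int k) (2 * k - 1)) =
          (\<Sum>r<k. d r * exp_integral a h \<alpha> i (stencil_poly k a h v i r)))"

definition weno_JL ::
    "nat \<Rightarrow> real \<Rightarrow> real \<Rightarrow> real \<Rightarrow> (nat \<Rightarrow> real) \<Rightarrow> (int \<Rightarrow> real) \<Rightarrow> int \<Rightarrow> real" where
  "weno_JL k a h \<alpha> d v i =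
     (\<Sum>r<k. weno_weight k d (\<lambda>r. smoothness a h k i (stencil_poly k a h v i r)) r *
             exp_integral a h \<alpha> i (stencil_poly k a h v i r))"

primrec weno_IL ::
    "nat \<Rightarrow> real \<Rightarrow> real \<Rightarrow> real \<Rightarrow> (nat \<Rightarrow> real) \<Rightarrow> (int \<Rightarrow> real) \<Rightarrow> nat \<Rightarrow> real" where
  "weno_IL k a h \<alpha> d v 0 = 0"
| "weno_IL k a h \<alpha> d v (Suc i) =
     weno_IL k a h \<alpha> d v i * exp (- \<alpha> * h) + weno_JL k a h \<alpha> d v (int (Suc i))"

text \<open>Mirror image of \<^const>\<open>weno_IL\<close>: it satisfies \<open>I\<^sub>M = 0\<close> and
  \<open>I\<^sub>i = I\<^sub>i\<^sub>+\<^sub>1 exp (- \<alpha> h) + J\<^sub>i\<close> with the reflected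
  \<^const>\<open>weno_JL\<close> as \<open>J\<^sub>i\<close>.\<close>

definition weno_IR ::
    "nat \<Rightarrow> real \<Rightarrow> real \<Rightarrow> nat \<Rightarrow> real \<Rightarrow> (nat \<Rightarrow> real) \<Rightarrow> (int \<Rightarrow> real) \<Rightarrow> nat \<Rightarrow> real" where
  "weno_IR k a h M \<alpha> d v i = weno_IL k a h \<alpha> d (\<lambda>j. v (int M - j)) (M - i)"

text \<open>The ghost value at \<open>x\<^sub>-\<^sub>i\<close>.\<close>

definition weno_extrapolate :: "nat \<Rightarrow> real \<Rightarrow> real \<Rightarrow> (nat \<Rightarrow> real) \<Rightarrow> nat \<Rightarrow> real" where
  "weno_extrapolate k a h v i =
     (let p = (\<lambda>r. interp_poly a h (\<lambda>j. v (nat j)) 0 r);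
          d = (\<lambda>r. if r \<le> 2 * k - 3 then h ^ (2 * k - 2 - r)
                   else 1 - (\<Sum>r\<le>2 * k - 3. h ^ (2 * k - 2 - r)));
          \<beta> = (\<lambda>r. if r = 0 then h\<^sup>2 else smoothness a h r 0 (p r))
      in \<Sum>r\<le>2 * k - 2. weno_weight (2 * k - 1) d \<beta> r * poly (p r) (node a h (- int i)))"

definition with_ghosts ::
    "boundary \<Rightarrow> nat \<Rightarrow> real \<Rightarrow> real \<Rightarrow> nat \<Rightarrow> (nat \<Rightarrow> real) \<Rightarrow> int \<Rightarrow> real" where
  "with_ghosts bc k a h M v j =
     (if 0 \<le> j \<and> j \<le> int M then v (nat j)
      else if bc = Periodic then v (nat (j mod int M))
      else if j < 0 then weno_extrapolate k a h v (nat (- j))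
      else weno_extrapolate k a h (mirror M v) (nat (j - int M)))"

text \<open>\<open>\<sigma>\<close> stands for \<open>c a\<^sub>m\<^sub>m\<close>, \<open>w\<close> for the grid function \<open>w\<close> of
  the stage and \<open>u\<close> for the stage values. The constant \<open>K\<close> is the prescribed boundary constant
  (\<open>A\<close> or \<open>B\<close>, according to the sign of \<open>\<sigma>\<close>); it is used only when the
  boundary condition is not periodic.\<close>

definition weno_stage ::
    "boundary \<Rightarrow> nat \<Rightarrow> real \<Rightarrow> real \<Rightarrow> nat \<Rightarrow> real \<Rightarrow> real \<Rightarrow> real \<Rightarrow>
     (nat \<Rightarrow> real) \<Rightarrow> (nat \<Rightarrow> real) \<Rightarrow> (nat \<Rightarrow> real) \<Rightarrow> bool" where
  "weno_stage bc k a b M dt \<sigma> K un w u \<longleftrightarrow>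
     (let h = (b - a) / real M;
          \<alpha> = 1 / \<bar>\<sigma> * dt\<bar>;
          x = (\<lambda>i. node a h (int i));
          v = with_ghosts bc k a h M w
      in \<exists>d. (\<forall>i\<in>{1..M}. linear_weights k a h \<alpha> (int i) d) \<and>
        (if \<sigma> > 0 then
           let I = weno_IL k a h \<alpha> d v;
               A = (if bc = Periodic
                    then ((\<Sum>i=0..<M. un i) - (\<Sum>i=0..<M. I i)) /
                         (\<Sum>i=0..<M. exp (- real i * \<alpha> * h))
                    else K)
           in \<forall>i\<le>M. u i = (if bc = Periodic \<and> i = M then u 0
                           else I i + A * exp (- \<alpha> * (x i - a)))
         else
           let I = weno_IR k a h M \<alpha> d v;
               B = (if bc = Periodic
                    then ((\<Sum>i=1..M. un i) - (\<Sum>i=1..M. I i)) /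
                         (\<Sum>i=1..M. exp (- real (M - i) * \<alpha> * h))
                    else K)
           in \<forall>i\<le>M. u i = (if bc = Periodic \<and> i = 0 then u M
                           else I i + B * exp (- \<alpha> * (b - x i)))))"

definition diag_part :: "real^'s^'s \<Rightarrow> real^'s^'s" where
  "diag_part A = (\<chi> i j. if i = j then A $ i $ i else 0)"

text \<open>\<open>U i $ m\<close> is the value of stage \<open>m\<close> at \<open>x\<^sub>i\<close>. For lower triangular
  \<open>A\<close> the matrix \<open>(A - \<Lambda>) A\<^sup>-\<^sup>1\<close> is strictly lower triangular, so the condition below
  determines the stages one after the other.\<close>

definition weno_molt_step ::
    "boundary \<Rightarrow> nat \<Rightarrow> real^'s^'s \<Rightarrow> real^'s \<Rightarrow> real \<Rightarrow> real \<Rightarrow> real \<Rightarrow> nat \<Rightarrow> real \<Rightarrow> ('s \<Rightarrow> real) \<Rightarrow>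
     (nat \<Rightarrow> real) \<Rightarrow> (nat \<Rightarrow> real) \<Rightarrow> bool" where
  "weno_molt_step bc k A wt a b c M dt K un un1 \<longleftrightarrow>
     (\<exists>U :: nat \<Rightarrow> real^'s.
        (\<forall>m. weno_stage bc k a b M dt (c * A $ m $ m) (K m) un
               (\<lambda>i. (un i *s ((diag_part A ** matrix_inv A) *v 1) +
                     ((A - diag_part A) ** matrix_inv A) *v U i) $ m)
               (\<lambda>i. U i $ m)) \<and>
        (\<forall>i\<le>M. un1 i = un i + wt \<bullet> (matrix_inv A *v (U i - un i *s 1))))"

text \<open>All fluxes are indexed by \<open>i\<close> for the interface \<open>i - 1/2\<close>. Everything up to
  \<open>limiter_pos\<close> is for positive \<open>c\<close>.\<close>

primrec flux_hat :: "real \<Rightarrow> real \<Rightarrow> (nat \<Rightarrow> real) \<Rightarrow> (nat \<Rightarrow> real) \<Rightarrow> nat \<Rightarrow> real" where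
  "flux_hat dx dt un un1 0 = 0"
| "flux_hat dx dt un un1 (Suc i) = flux_hat dx dt un un1 i - dx / dt * (un1 i - un i)"

primrec flux_bounded :: "real \<Rightarrow> real \<Rightarrow> (nat \<Rightarrow> real) \<Rightarrow> (nat \<Rightarrow> real) \<Rightarrow> nat \<Rightarrow> real" where
  "flux_bounded dx dt un un1 0 = flux_hat dx dt un un1 0"
| "flux_bounded dx dt un un1 (Suc i) =
     (if i \<noteq> 0 \<and> un i - dt / dx * (flux_hat dx dt un un1 (Suc i) - flux_bounded dx dt un un1 i) < 0
      then flux_bounded dx dt un un1 i + dx / dt * un i
      else flux_hat dx dt un un1 (Suc i))"

primrec flux_sweep1 :: "real \<Rightarrow> real \<Rightarrow> (nat \<Rightarrow> real) \<Rightarrow> (nat \<Rightarrow> real) \<Rightarrow> nat \<Rightarrow> real" where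
  "flux_sweep1 dx dt un un1 0 = flux_hat dx dt un un1 0"
| "flux_sweep1 dx dt un un1 (Suc i) =
     (if un i - dt / dx * (flux_hat dx dt un un1 (Suc i) - flux_sweep1 dx dt un un1 i) < 0
      then flux_sweep1 dx dt un un1 i + dx / dt * un i
      else flux_hat dx dt un un1 (Suc i))"

text \<open>The boolean component says whether the second sweep is still running.\<close>

primrec flux_sweep2 ::
    "nat \<Rightarrow> real \<Rightarrow> real \<Rightarrow> (nat \<Rightarrow> real) \<Rightarrow> (nat \<Rightarrow> real) \<Rightarrow> nat \<Rightarrow> real \<times> bool" where
  "flux_sweep2 M dx dt un un1 0 = (flux_sweep1 dx dt un un1 M, True)"
| "flux_sweep2 M dx dt un un1 (Suc i) =
     (let (f, running) = flux_sweep2 M dx dt un un1 i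
      in if running \<and> un i - dt / dx * (flux_sweep1 dx dt un un1 (Suc i) - f) < 0
         then (f + dx / dt * un i, True)
         else (flux_sweep1 dx dt un un1 (Suc i), False))"

definition limiter_pos ::
    "boundary \<Rightarrow> nat \<Rightarrow> real \<Rightarrow> real \<Rightarrow> (nat \<Rightarrow> real) \<Rightarrow> (nat \<Rightarrow> real) \<Rightarrow> nat \<Rightarrow> real" where
  "limiter_pos bc M dx dt un un1 i =
     (if bc = Periodic then
        let f = (\<lambda>j. fst (flux_sweep2 M dx dt un un1 j));
            l = (if i = M then 0 else i)
        in un l - dt / dx * (f (Suc l) - f l)
      else
        un i - dt / dx * (flux_bounded dx dt un un1 (Suc i) - flux_bounded dx dt un un1 i))"

definition limiter ::
    "boundary \<Rightarrow> real \<Rightarrow> nat \<Rightarrow> real \<Rightarrow> real \<Rightarrow> (nat \<Rightarrow> real) \<Rightarrow> (nat \<Rightarrow> real) \<Rightarrow> nat \<Rightarrow> real" where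
  "limiter bc c M dx dt un un1 =
     (if c > 0 then limiter_pos bc M dx dt un un1
      else mirror M (limiter_pos bc M dx dt (mirror M un) (mirror M un1)))"

end

theory Submission
  imports Defs
begin

text \<open>Measured relative to the unlimited flux and scaled by \<open>dt / dx\<close>, the modified flux at
  the interface \<open>i + 1/2\<close> is \<open>D\<^sub>i\<^sub>+\<^sub>1 = min 0 (D\<^sub>i + u\<^sub>i)\<close> with \<open>u\<^sub>i\<close>
  the unlimited value. Since the exact solution is nonnegative, \<open>u\<^sub>i \<ge> - E\<close> for the error
  bound \<open>E\<close>, so \<open>D\<close> loses at most \<open>E\<close> per cell and stays between
  \<open>- M E\<close> and \<open>0\<close>; the factor \<open>M = (b - a) / dx\<close> is the lost order. In the periodic
  case the scheme conserves the sum of the grid values, hence the second sweep starts from the final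
  correction of the first one, and its correction shrinks because the values left by
  the first sweep are nonnegative.\<close>

section \<open>Size and sign of the flux corrections\<close>

text \<open>\<open>P\<close> marks the cells that may be clipped: every cell in the first periodic
  sweep, every cell but 0 for \<open>flux_bounded\<close>. One recursion thus covers both
  limiters.\<close>

lemma flux_correction_bounds:
  fixes f :: "nat \<Rightarrow> real"
  assumes "dx > 0" "dt > 0" and f0: "f 0 = 0"
    and f_Suc: "\<And>i. f (Suc i) =
      (if P i \<and> un i - dt / dx * (flux_hat dx dt un un1 (Suc i) - f i) < 0
       then f i + dx / dt * un i else flux_hat dx dt un un1 (Suc i))"
    and lower: "\<And>i. i < n \<Longrightarrow> un1 i \<ge> - E" and "E \<ge> 0" and "m \<le> n"
  shows "dt / dx * (f m - flux_hat dx dt un un1 m) \<in> {- (real m * E)..0}"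
  using \<open>m \<le> n\<close>
proof (induction m)
  case 0
  then show ?case using f0 by simp
next
  case (Suc m)
  let ?h = "flux_hat dx dt un un1"
  have IH: "dt / dx * (f m - ?h m) \<in> {- (real m * E)..0}" and "un1 m \<ge> - E"
    using Suc lower[of m] by auto
  show ?case
  proof (cases "P m \<and> un m - dt / dx * (?h (Suc m) - f m) < 0")
    case True
    have "f (Suc m) = f m + dx / dt * un m"
      by (subst f_Suc) (rule if_P[OF True])
    then have "dt / dx * (f (Suc m) - ?h (Suc m)) = dt / dx * (f m - ?h m) + un1 m"
      using assms(1,2) by (simp add: field_simps)
    \<comment> \<open>The new correction is the tested quantity itself, negative in this case;
      \<open>un1 m \<ge> - E\<close> limits the loss in this cell.\<close>
    moreover have "dt / dx * (f m - ?h m) + un1 m = un m - dt / dx * (?h (Suc m) - f m)"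
      using assms(1,2) by (simp add: field_simps)
    ultimately show ?thesis using True IH \<open>un1 m \<ge> - E\<close>
      by (simp add: distrib_right del: flux_hat.simps)
  next
    case False
    have "f (Suc m) = ?h (Suc m)"
      by (subst f_Suc) (rule if_not_P[OF False])
    then show ?thesis using \<open>E \<ge> 0\<close> by simp
  qed
qed

text \<open>The unlimited flux reproduces \<open>un1\<close>, so a limited value deviates from it
  only by a difference of neighbouring corrections.\<close>

lemma flux_difference_eq:
  assumes "dx > 0" "dt > 0"
  shows "un i - dt / dx * (f (Suc i) - f i) =
    un1 i - (dt / dx * (f (Suc i) - flux_hat dx dt un un1 (Suc i))
             - dt / dx * (f i - flux_hat dx dt un un1 i))"
  using assms by (simp add: field_simps)

text \<open>Needed for \<open>m = M\<close>, where conservation over a period makes the flux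
  vanish.\<close>

lemma flux_hat_eq_sum:
  "flux_hat dx dt un un1 m = - dx / dt * ((\<Sum>i<m. un1 i) - (\<Sum>i<m. un i))"
  by (induction m) (simp_all add: algebra_simps diff_divide_distrib add_divide_distrib)

text \<open>A clipped cell is brought to exactly 0; any other cell has passed the test.\<close>

lemma flux_sweep1_nonneg:
  assumes "dx > 0" "dt > 0"
  shows "un i - dt / dx * (flux_sweep1 dx dt un un1 (Suc i) - flux_sweep1 dx dt un un1 i) \<ge> 0"
  using assms by (auto simp del: flux_hat.simps)

text \<open>While the second sweep runs, its correction relative to the first increases by a
  nonnegative cell value of the first sweep, yet stays negative because the test fires; after the
  stop it is 0. The initial bound \<open>B\<close> therefore persists with no further loss per
  cell.\<close>

lemma flux_sweep2_correction_bounds: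
  assumes "dx > 0" "dt > 0"
    and start: "dt / dx * flux_sweep1 dx dt un un1 M \<in> {- B..0}"
  shows "dt / dx * (fst (flux_sweep2 M dx dt un un1 m) - flux_sweep1 dx dt un un1 m) \<in> {- B..0}"
proof (induction m)
  case 0
  \<comment> \<open>The first sweep begins with flux 0, so the initial correction is the whole flux
    carried over from interface \<open>M\<close>.\<close>
  then show ?case using start by simp
next
  case (Suc m)
  let ?s = "flux_sweep1 dx dt un un1"
  obtain f r where fr: "flux_sweep2 M dx dt un un1 m = (f, r)" by fastforce
  have IH: "dt / dx * (f - ?s m) \<in> {- B..0}" using Suc fr by simp
  show ?case
  proof (cases "r \<and> un m - dt / dx * (?s (Suc m) - f) < 0")
    case True
    then have "fst (flux_sweep2 M dx dt un un1 (Suc m)) = f + dx / dt * un m"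
      using fr by (simp del: flux_sweep1.simps)
    moreover have "dt / dx * (f + dx / dt * un m - ?s (Suc m)) =
        dt / dx * (f - ?s m) + (un m - dt / dx * (?s (Suc m) - ?s m))"
      using assms(1,2) by (simp add: field_simps del: flux_sweep1.simps)
    moreover have "dt / dx * (f + dx / dt * un m - ?s (Suc m)) =
        un m - dt / dx * (?s (Suc m) - f)"
      using assms(1,2) by (simp add: field_simps del: flux_sweep1.simps)
    ultimately show ?thesis
      using IH True flux_sweep1_nonneg[OF assms(1,2), of un m un1]
      by (simp del: flux_sweep1.simps)
  next
    case False
    then have "fst (flux_sweep2 M dx dt un un1 (Suc m)) = ?s (Suc m)"
      using fr by (auto simp del: flux_sweep1.simps)
    \<comment> \<open>The correction is 0 here; \<open>start\<close> supplies
      \<open>B \<ge> 0\<close>, its interval being nonempty.\<close>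
    then show ?thesis using start by (auto simp del: flux_sweep1.simps)
  qed
qed

section \<open>Deviation of the limited values from the unlimited ones\<close>

text \<open>Corrections have one sign, so the difference of two neighbours obeys their common bound,
  not twice it. In the periodic case each of the two sweeps contributes
  \<open>real M * E\<close>.\<close>

lemma limiter_pos_deviation:
  assumes "dx > 0" "dt > 0" "M > 0" "E \<ge> 0"
    and lower: "\<And>i. i \<le> M \<Longrightarrow> un1 i \<ge> - E"
    and conserved: "bc = Periodic \<Longrightarrow> (\<Sum>i<M. un1 i) = (\<Sum>i<M. un i)"
    and wrap: "bc = Periodic \<Longrightarrow> un1 0 = un1 M"
    and "i \<le> M"
  shows "\<bar>limiter_pos bc M dx dt un un1 i - un1 i\<bar> \<le> 2 * real M * E"
proof (cases "bc = Periodic")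
  case True
  let ?s = "flux_sweep1 dx dt un un1" and ?h = "flux_hat dx dt un un1"
  define g where "g = (\<lambda>j. fst (flux_sweep2 M dx dt un un1 j))"
  define l where "l = (if i = M then 0 else i)"
  have l: "l < M" "un1 l = un1 i"
    using True wrap \<open>M > 0\<close> \<open>i \<le> M\<close> by (auto simp: l_def)
  have first: "dt / dx * (?s m - ?h m) \<in> {- (real M * E)..0}" if "m \<le> M" for m
  proof -
    have "dt / dx * (?s m - ?h m) \<in> {- (real m * E)..0}"
      by (rule flux_correction_bounds[where P = "\<lambda>_. True" and n = M])
         (use assms that in \<open>auto intro: less_imp_le\<close>)
    moreover have "real m * E \<le> real M * E"
      using that \<open>E \<ge> 0\<close> by (simp add: mult_right_mono)
    ultimately show ?thesis by auto
  qed
  \<comment> \<open>With zero unlimited flux after a full period, the flux handed to the second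
    sweep is purely the correction left by the first.\<close>
  have "?h M = 0" using conserved[OF True] by (simp add: flux_hat_eq_sum)
  then have "dt / dx * ?s M \<in> {- (real M * E)..0}" using first[of M] by simp
  from flux_sweep2_correction_bounds[OF assms(1,2) this]
  have second: "dt / dx * (g m - ?s m) \<in> {- (real M * E)..0}" for m by (simp add: g_def)
  have "limiter_pos bc M dx dt un un1 i = un l - dt / dx * (g (Suc l) - g l)"
    using True by (simp add: limiter_pos_def g_def l_def Let_def)
  also have "\<dots> = un1 l - (dt / dx * (g (Suc l) - ?h (Suc l)) - dt / dx * (g l - ?h l))"
    by (rule flux_difference_eq[OF assms(1,2)])
  \<comment> \<open>Four terms in \<open>{- (real M * E)..0}\<close>, two of each sign: hence the
    factor 2.\<close>
  finally have "limiter_pos bc M dx dt un un1 i - un1 i =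
      dt / dx * (g l - ?s l) + dt / dx * (?s l - ?h l)
      - dt / dx * (g (Suc l) - ?s (Suc l)) - dt / dx * (?s (Suc l) - ?h (Suc l))"
    using l by (simp add: algebra_simps del: flux_sweep1.simps flux_hat.simps)
  then show ?thesis
    using first[of l] first[of "Suc l"] second[of l] second[of "Suc l"] l
    by (simp add: abs_le_iff del: flux_sweep1.simps flux_hat.simps)
next
  case False
  let ?f = "flux_bounded dx dt un un1" and ?h = "flux_hat dx dt un un1"
  have bound: "dt / dx * (?f m - ?h m) \<in> {- (2 * real M * E)..0}" if "m \<le> Suc M" for m
  proof -
    have "dt / dx * (?f m - ?h m) \<in> {- (real m * E)..0}"
      by (rule flux_correction_bounds[where P = "\<lambda>i. i \<noteq> 0" and n = "Suc M"])
         (use assms that in \<open>auto\<close>)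
    \<comment> \<open>\<open>m\<close> can be \<open>Suc M\<close>, because all M + 1 cells are
      updated; \<open>M > 0\<close> gives M + 1 \<le> 2 M.\<close>
    moreover have "real m * E \<le> 2 * real M * E"
      using that \<open>E \<ge> 0\<close> \<open>M > 0\<close> by (intro mult_right_mono) auto
    ultimately show ?thesis by auto
  qed
  have "limiter_pos bc M dx dt un un1 i = un i - dt / dx * (?f (Suc i) - ?f i)"
    using False by (simp add: limiter_pos_def)
  also have "\<dots> = un1 i - (dt / dx * (?f (Suc i) - ?h (Suc i)) - dt / dx * (?f i - ?h i))"
    by (rule flux_difference_eq[OF assms(1,2)])
  finally show ?thesis
    using bound[of i] bound[of "Suc i"] \<open>i \<le> M\<close>
    by (simp add: abs_le_iff del: flux_bounded.simps flux_hat.simps)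
qed

lemma sum_Suc_eq_of_wrap:
  fixes v :: "nat \<Rightarrow> real"
  assumes "v 0 = v M"
  shows "(\<Sum>i<M. v (Suc i)) = (\<Sum>i<M. v i)"
  using assms sum.lessThan_Suc[of v M] sum.lessThan_Suc_shift[of v M] by simp

text \<open>Reflection carries the nodes 0, ..., M - 1 to M, ..., 1, so it merely trades one
  endpoint for the other.\<close>

lemma sum_mirror:
  assumes "v 0 = v M"
  shows "(\<Sum>i<M. mirror M v i) = (\<Sum>i<M. v i)"
proof -
  have "(\<Sum>i<M. mirror M v i) = (\<Sum>i<M. v (Suc (M - Suc i)))"
    by (intro sum.cong) (auto simp: mirror_def Suc_diff_Suc)
  also have "\<dots> = (\<Sum>i<M. v (Suc i))"
    by (rule sum.nat_diff_reindex)
  finally show ?thesis using sum_Suc_eq_of_wrap[of v M] assms by simp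
qed

lemma limiter_deviation:
  assumes "dx > 0" "dt > 0" "M > 0" "E \<ge> 0"
    and lower: "\<And>i. i \<le> M \<Longrightarrow> un1 i \<ge> - E"
    and periodic: "bc = Periodic \<Longrightarrow>
      (\<Sum>i<M. un1 i) = (\<Sum>i<M. un i) \<and> un1 0 = un1 M \<and> un 0 = un M"
    and "i \<le> M"
  shows "\<bar>limiter bc c M dx dt un un1 i - un1 i\<bar> \<le> 2 * real M * E"
proof (cases "c > 0")
  case True
  have "\<bar>limiter_pos bc M dx dt un un1 i - un1 i\<bar> \<le> 2 * real M * E"
    by (rule limiter_pos_deviation) (use assms in auto)
  then show ?thesis using True by (simp add: limiter_def)
next
  case False
  have "\<bar>limiter_pos bc M dx dt (mirror M un) (mirror M un1) (M - i) - mirror M un1 (M - i)\<bar>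
      \<le> 2 * real M * E"
  proof (rule limiter_pos_deviation[OF assms(1-4)])
    show "mirror M un1 j \<ge> - E" if "j \<le> M" for j
      using lower[of "M - j"] by (simp add: mirror_def)
    show "(\<Sum>i<M. mirror M un1 i) = (\<Sum>i<M. mirror M un i)" if "bc = Periodic"
      using periodic[OF that] sum_mirror[of un1 M] sum_mirror[of un M] by simp
    show "mirror M un1 0 = mirror M un1 M" if "bc = Periodic"
      using periodic[OF that] by (simp add: mirror_def)
  qed simp
  then show ?thesis using False \<open>i \<le> M\<close> by (simp add: limiter_def mirror_def)
qed

section \<open>Conservation of the sum over a period by the scheme\<close>

text \<open>The boundary constant solves exactly the scalar equation by which adding that multiple
  of the exponential profile to \<open>I\<close> restores the sum of \<open>un\<close>.\<close>

lemma weno_stage_conserves: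
  assumes "M > 0" and wrap: "un 0 = un M"
    and stage: "weno_stage Periodic k a b M dt \<sigma> K un w u"
  shows "(\<Sum>i<M. u i) = (\<Sum>i<M. un i)" and "u 0 = u M"
proof -
  define h \<alpha> where "h = (b - a) / real M" and "\<alpha> = 1 / \<bar>\<sigma> * dt\<bar>"
  have Mh: "real M * h = b - a" using \<open>M > 0\<close> by (simp add: h_def)
  have "(\<Sum>i<M. u i) = (\<Sum>i<M. un i) \<and> u 0 = u M"
  proof (cases "\<sigma> > 0")
    case True
    let ?S = "\<Sum>i<M. exp (- real i * \<alpha> * h)"
    obtain I where u: "\<And>i. i \<le> M \<Longrightarrow> u i = (if i = M then u 0
        else I i + ((\<Sum>i<M. un i) - (\<Sum>i<M. I i)) / ?S * exp (- \<alpha> * (node a h (int i) - a)))"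
      using stage True
      unfolding weno_stage_def Let_def h_def[symmetric] \<alpha>_def[symmetric] simp_thms if_True atLeast0LessThan
      by auto
    have "?S > 0" using \<open>M > 0\<close> by (intro sum_pos) auto
    have "(\<Sum>i<M. u i) =
        (\<Sum>i<M. I i + ((\<Sum>i<M. un i) - (\<Sum>i<M. I i)) / ?S * exp (- real i * \<alpha> * h))"
      by (intro sum.cong) (auto simp: u node_def algebra_simps)
    also have "\<dots> = (\<Sum>i<M. I i) + ((\<Sum>i<M. un i) - (\<Sum>i<M. I i)) / ?S * ?S"
      by (simp only: sum.distrib sum_distrib_left)
    also have "\<dots> = (\<Sum>i<M. un i)" using \<open>?S > 0\<close> by simp
    finally show ?thesis using u[of M] by simp
  next
    case False
    let ?S = "\<Sum>i=1..M. exp (- real (M - i) * \<alpha> * h)"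
    obtain I where u: "\<And>i. i \<le> M \<Longrightarrow> u i = (if i = 0 then u M
        else I i + ((\<Sum>i=1..M. un i) - (\<Sum>i=1..M. I i)) / ?S * exp (- \<alpha> * (b - node a h (int i))))"
      using stage False
      unfolding weno_stage_def Let_def h_def[symmetric] \<alpha>_def[symmetric] simp_thms if_True
      by auto
    \<comment> \<open>The right-to-left constant balances sums over 1, ..., M; equality of the
      endpoint values, for \<open>u\<close> and for \<open>un\<close>, moves both to 0, ..., M -
      1.\<close>
    have shift: "(\<Sum>i=1..M. v i) = (\<Sum>i<M. v i)" if "v 0 = v M" for v :: "nat \<Rightarrow> real"
      using sum_Suc_eq_of_wrap[OF that] by (simp add: sum.atLeast1_atMost_eq)
    have "?S > 0" using \<open>M > 0\<close> by (intro sum_pos) auto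
    have exponent: "- (\<alpha> * (b - node a h (int i))) = - real (M - i) * \<alpha> * h"
      if "i \<le> M" for i
    proof -
      have "b - node a h (int i) = real (M - i) * h"
        using Mh that by (simp add: node_def of_nat_diff algebra_simps)
      then show ?thesis by simp
    qed
    have "(\<Sum>i=1..M. u i) =
        (\<Sum>i=1..M. I i + ((\<Sum>i=1..M. un i) - (\<Sum>i=1..M. I i)) / ?S * exp (- real (M - i) * \<alpha> * h))"
      by (intro sum.cong) (auto simp: u exponent)
    also have "\<dots> = (\<Sum>i=1..M. I i) + ((\<Sum>i=1..M. un i) - (\<Sum>i=1..M. I i)) / ?S * ?S"
      by (simp only: sum.distrib sum_distrib_left)
    also have "\<dots> = (\<Sum>i=1..M. un i)" using \<open>?S > 0\<close> by simp
    finally show ?thesis using shift[of u] shift[of un] wrap u[of 0] by simp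
  qed
  then show "(\<Sum>i<M. u i) = (\<Sum>i<M. un i)" and "u 0 = u M" by auto
qed

text \<open>The increment of a step is linear in \<open>U i - un i *s 1\<close>, and these vectors
  sum to 0 because each stage conserves the sum.\<close>

lemma weno_molt_step_conserves:
  assumes "M > 0" and wrap: "un 0 = un M"
    and "weno_molt_step Periodic k A wt a b c M dt K un un1"
  shows "(\<Sum>i<M. un1 i) = (\<Sum>i<M. un i)" and "un1 0 = un1 M"
proof -
  obtain U where stage: "\<And>m. weno_stage Periodic k a b M dt (c * A $ m $ m) (K m) un
               (\<lambda>i. (un i *s ((diag_part A ** matrix_inv A) *v 1) +
                     ((A - diag_part A) ** matrix_inv A) *v U i) $ m)
               (\<lambda>i. U i $ m)"
    and un1: "\<And>i. i \<le> M \<Longrightarrow> un1 i = un i + wt \<bullet> (matrix_inv A *v (U i - un i *s 1))"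
    using assms(3) unfolding weno_molt_step_def by blast
  have "(\<Sum>i<M. U i - un i *s 1) = 0"
    using weno_stage_conserves(1)[OF assms(1,2) stage]
    by (simp add: vec_eq_iff sum_subtractf)
  moreover have "(\<Sum>i<M. wt \<bullet> (matrix_inv A *v (U i - un i *s 1))) =
      wt \<bullet> (matrix_inv A *v (\<Sum>i<M. U i - un i *s 1))"
    by (simp add: inner_sum_right linear_sum[OF matrix_vector_mul_linear])
  ultimately show "(\<Sum>i<M. un1 i) = (\<Sum>i<M. un i)"
    by (simp add: un1 sum.distrib)
  have "U 0 = U M"
    using weno_stage_conserves(2)[OF assms(1,2) stage] by (simp add: vec_eq_iff)
  then show "un1 0 = un1 M" using un1[of 0] un1[of M] wrap by simp
qed

section \<open>Error estimate for the limited solution\<close>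

theorem proposition2p1:
  fixes a b c p q :: real
    and k :: nat
    and A :: "real^('s::{finite,linorder})^('s::{finite,linorder})" and wt :: "real^('s::{finite,linorder})"
    and bc :: boundary and u0 :: "real \<Rightarrow> real" and u :: "real \<Rightarrow> real \<Rightarrow> real"
    and M :: "'j \<Rightarrow> nat" and dx dt t :: "'j \<Rightarrow> real"
    and K :: "'j \<Rightarrow> 's::{finite,linorder} \<Rightarrow> real"
    and un un1 :: "'j \<Rightarrow> nat \<Rightarrow> real"
  assumes "a < b" and "c \<noteq> 0" and "k \<ge> 2"
    and lower_triangular: "\<forall>l m. l < m \<longrightarrow> A $ l $ m = 0"
    and nonzero_diagonal: "\<forall>m. A $ m $ m \<noteq> 0"
    and exact: "advection_solution a b c bc u0 u"
    and u0_nonneg: "\<forall>x\<in>{a..b}. u0 x \<ge> 0"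
    and u_nonneg: "\<forall>x\<in>{a..b}. \<forall>\<tau>\<ge>0. u x \<tau> \<ge> 0"
    and grid: "\<forall>j. M j > 0 \<and> dx j = (b - a) / real (M j)"
    and time: "\<forall>j. dt j > 0 \<and> t j \<ge> 0"
    and dt_bigo: "\<exists>L. \<forall>j. dt j \<le> L * dx j"
    and un_nonneg: "\<forall>j. \<forall>i\<le>M j. un j i \<ge> 0"
    and un_periodic: "bc = Periodic \<longrightarrow> (\<forall>j. un j 0 = un j (M j))"
    and step: "\<forall>j. weno_molt_step bc k A wt a b c (M j) (dt j) (K j) (un j) (un1 j)"
    and accuracy: "\<exists>C. \<forall>j. \<forall>i\<le>M j.
      \<bar>un1 j i - u (node a (dx j) (int i)) (t j + dt j)\<bar> \<le> C * (dx j powr p + dt j powr q)"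
  shows "\<exists>C'. \<forall>j. \<forall>i\<le>M j.
      \<bar>limiter bc c (M j) (dx j) (dt j) (un j) (un1 j) i - u (node a (dx j) (int i)) (t j + dt j)\<bar>
        \<le> C' * (dx j powr (p - 1) + dx j powr (- 1) * dt j powr q)"
proof -
  obtain C where C: "\<And>j i. i \<le> M j \<Longrightarrow>
      \<bar>un1 j i - u (node a (dx j) (int i)) (t j + dt j)\<bar> \<le> C * (dx j powr p + dt j powr q)"
    using accuracy by blast
  \<comment> \<open>The 3 collects 2 from the limiter and 1 from the unlimited error;
    \<open>b - a\<close> comes from \<open>M j = (b - a) / dx j\<close>.\<close>
  have "\<bar>limiter bc c (M j) (dx j) (dt j) (un j) (un1 j) i - u (node a (dx j) (int i)) (t j + dt j)\<bar>
      \<le> 3 * (b - a) * C * (dx j powr (p - 1) + dx j powr (- 1) * dt j powr q)"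
    if "i \<le> M j" for i j
  proof -
    define E where "E = C * (dx j powr p + dt j powr q)"
    have "M j > 0" and dx: "dx j = (b - a) / real (M j)" using grid by auto
    then have "dx j > 0" and M: "real (M j) = (b - a) / dx j" using \<open>a < b\<close> by auto
    have "dt j > 0" "t j \<ge> 0" using time by auto
    \<comment> \<open>\<open>C\<close> has no prescribed sign, but the absolute error at node 0 is
      at most \<open>E\<close>.\<close>
    have "E \<ge> 0" using order_trans[OF abs_ge_zero C[of 0 j]] by (simp add: E_def)
    have lower: "un1 j l \<ge> - E" if "l \<le> M j" for l
    proof -
      have "real l * dx j \<le> real (M j) * dx j"
        using that \<open>dx j > 0\<close> by (simp add: mult_right_mono)
      then have "node a (dx j) (int l) \<in> {a..b}"
        using \<open>dx j > 0\<close> M by (simp add: node_def)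
      then have "u (node a (dx j) (int l)) (t j + dt j) \<ge> 0"
        using u_nonneg \<open>dt j > 0\<close> \<open>t j \<ge> 0\<close> by simp
      then show ?thesis using C[OF that] by (simp add: E_def abs_le_iff)
    qed
    have "(\<Sum>i<M j. un1 j i) = (\<Sum>i<M j. un j i) \<and> un1 j 0 = un1 j (M j) \<and> un j 0 = un j (M j)"
      if "bc = Periodic"
      using weno_molt_step_conserves[OF \<open>M j > 0\<close>, of "un j"] un_periodic step that by blast
    from limiter_deviation[OF \<open>dx j > 0\<close> \<open>dt j > 0\<close> \<open>M j > 0\<close> \<open>E \<ge> 0\<close> lower this \<open>i \<le> M j\<close>, where c = c]
    have "\<bar>limiter bc c (M j) (dx j) (dt j) (un j) (un1 j) i - un1 j i\<bar> \<le> 2 * real (M j) * E"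
      by simp
    \<comment> \<open>The unlimited error is absorbed into the larger limiter term, using
      \<open>M j \<ge> 1\<close>.\<close>
    moreover have "E \<le> real (M j) * E"
      using \<open>M j > 0\<close> \<open>E \<ge> 0\<close> mult_right_mono[of 1 "real (M j)" E] by simp
    ultimately have "\<bar>limiter bc c (M j) (dx j) (dt j) (un j) (un1 j) i
        - u (node a (dx j) (int i)) (t j + dt j)\<bar> \<le> 3 * real (M j) * E"
      using C[OF \<open>i \<le> M j\<close>] by (simp add: E_def[symmetric])
    \<comment> \<open>Replacing \<open>M j\<close> by \<open>(b - a) / dx j\<close> divides both
      error terms by \<open>dx j\<close>: this is the lost order.\<close>
    also have "\<dots> = 3 * (b - a) * C * (dx j powr (p - 1) + dx j powr (- 1) * dt j powr q)"
      using \<open>dx j > 0\<close> by (simp add: M E_def powr_diff powr_minus field_simps)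
    finally show ?thesis .
  qed
  then show ?thesis by blast
qed

end
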